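(* Let $r$ and $s$ be non-negative integers with $r\ge 3s+8$. Then $F_v(2_r;r-s-2)\le r+2s+9$.
   Context: All graphs are finite, undirected, without loops or multiple edges. $\omega(G)$ is the clique number of $G$. $G\to^v(2_r)$ means that every partition of $V(G)$ into $r$ pairwise disjoint (possibly empty) classes has a class containing an edge, i.e. $\chi(G)\ge r+1$. $H_v(2_r;q)$ is the set of graphs $G$ with $G\to^v(2_r)$ and $\omega(G)<q$, and $F_v(2_r;q)=\min\{|V(G)|:G\in H_v(2_r;q)\}$ (it exists whenever $q\ge 3$). *)

theory Defs
  imports "Graph_Theory.Pair_Digraph"
begin

text \<open>
  A finite simple graph is a \<^term>\<open>G\<close> with \<^prop>\<open>pair_graph G\<close>: finite vertex set
  \<^term>\<open>pverts G\<close>, and an undirected edge \<open>{u, v}\<close> is encoded by the two arcs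
  \<open>(u, v)\<close> and \<open>(v, u)\<close> of the symmetric loopfree relation \<^term>\<open>parcs G\<close>.
\<close>

definition is_clique :: "'a pair_pre_digraph \<Rightarrow> 'a set \<Rightarrow> bool" where
  "is_clique G K \<longleftrightarrow>
     K \<subseteq> pverts G \<and> (\<forall>u\<in>K. \<forall>v\<in>K. u \<noteq> v \<longrightarrow> (u, v) \<in> parcs G)"

text \<open>The empty set is a clique, so the graph without vertices has clique number 0.\<close>

definition clique_number :: "'a pair_pre_digraph \<Rightarrow> nat" where
  "clique_number G = Max (card ` {K. is_clique G K})"

text \<open>
  The relation \<open>G \<rightarrow>\<^sup>v (2\<^sub>r)\<close>. The classes \<open>P i\<close> may be empty. For \<open>r = 0\<close> it says
  that \<open>G\<close> has a vertex.
\<close>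

definition vertex_arrow :: "'a pair_pre_digraph \<Rightarrow> nat \<Rightarrow> bool" where
  "vertex_arrow G r \<longleftrightarrow>
     (\<forall>P :: nat \<Rightarrow> 'a set.
        (\<Union>i<r. P i) = pverts G \<and> disjoint_family_on P {..<r} \<longrightarrow>
        (\<exists>i<r. \<exists>u\<in>P i. \<exists>v\<in>P i. (u, v) \<in> parcs G))"

definition H_v :: "nat \<Rightarrow> nat \<Rightarrow> 'a pair_pre_digraph set" where
  "H_v r q = {G. pair_graph G \<and> vertex_arrow G r \<and> clique_number G < q}"

text \<open>
  The minimum ranges over graphs whose vertices are natural numbers, which covers every
  finite graph up to isomorphism; see \<open>F_v_le_card\<close> below. The value is meaningful only
  if \<^term>\<open>H_v r q\<close> is nonempty, which is the case for \<^prop>\<open>q \<ge> 3\<close>.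
\<close>

definition F_v :: "nat \<Rightarrow> nat \<Rightarrow> nat" where
  "F_v r q = (LEAST n. \<exists>G \<in> (H_v r q :: nat pair_pre_digraph set). card (pverts G) = n)"


text \<open>\<open>G \<rightarrow>\<^sup>v (2\<^sub>r)\<close> means that \<open>G\<close> has no proper colouring with \<open>r\<close> colours.\<close>

lemma vertex_arrow_iff_not_colourable:
  assumes "pair_graph G"
  shows "vertex_arrow G r \<longleftrightarrow>
    \<not> (\<exists>c. c ` pverts G \<subseteq> {..<r} \<and> (\<forall>(u, v) \<in> parcs G. c u \<noteq> c v))"
    (is "_ \<longleftrightarrow> \<not> ?col")
proof -
  interpret pair_graph G by fact
  have "?col" if "\<not> vertex_arrow G r"
  proof -
    from that obtain P :: "nat \<Rightarrow> 'a set" where P: "(\<Union>i<r. P i) = pverts G"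
      "disjoint_family_on P {..<r}" "\<And>i u v. \<lbrakk>i < r; u \<in> P i; v \<in> P i\<rbrakk> \<Longrightarrow> (u, v) \<notin> parcs G"
      unfolding vertex_arrow_def by auto
    have "\<forall>u\<in>pverts G. \<exists>i. i < r \<and> u \<in> P i" using P(1) by blast
    then obtain c where "\<forall>u\<in>pverts G. c u < r \<and> u \<in> P (c u)" using bchoice by metis
    then have c: "c u < r \<and> u \<in> P (c u)" if "u \<in> pverts G" for u using that by simp
    have "c u \<noteq> c v" if uv: "(u, v) \<in> parcs G" for u v
    proof
      assume "c u = c v"
      then show False
        using uv c[OF in_arcsD1[OF uv]] c[OF in_arcsD2[OF uv]] P(3)[of "c u" u v] by simp
    qed
    moreover have "c ` pverts G \<subseteq> {..<r}" using c by auto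
    ultimately show ?thesis by blast
  qed
  moreover have "\<not> vertex_arrow G r" if ?col
  proof -
    from that obtain c where "c ` pverts G \<subseteq> {..<r} \<and> (\<forall>(u, v) \<in> parcs G. c u \<noteq> c v)" ..
    then have c: "c ` pverts G \<subseteq> {..<r}" "\<And>u v. (u, v) \<in> parcs G \<Longrightarrow> c u \<noteq> c v"
      by auto
    let ?P = "\<lambda>i. {u \<in> pverts G. c u = i}"
    have "(\<Union>i<r. ?P i) = pverts G" using c(1) by auto
    moreover have "disjoint_family_on ?P {..<r}" by (auto simp: disjoint_family_on_def)
    moreover have "\<not> (\<exists>i<r. \<exists>u\<in>?P i. \<exists>v\<in>?P i. (u, v) \<in> parcs G)"
    proof (intro notI, elim exE bexE conjE)
      fix i u v assume "u \<in> ?P i" "v \<in> ?P i" and uv: "(u, v) \<in> parcs G"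
      then have "c u = c v" by simp
      with c(2)[OF uv] show False by simp
    qed
    ultimately show ?thesis
      unfolding vertex_arrow_def not_all by (intro exI[of _ ?P]) simp
  qed
  ultimately show ?thesis by blast
qed

lemma F_v_le_card:
  fixes G :: "'a pair_pre_digraph"
  assumes "G \<in> H_v r q"
  shows "F_v r q \<le> card (pverts G)"
proof -
  from assms have G: "pair_graph G" and arr: "vertex_arrow G r" and cl: "clique_number G < q"
    by (auto simp: H_v_def)
  interpret pair_graph G by fact
  obtain f :: "'a \<Rightarrow> nat" where f: "inj_on f (pverts G)"
    using finite_imp_inj_to_nat_seg[OF pair_finite_verts] by blast
  define G' where "G' = \<lparr>pverts = f ` pverts G, parcs = map_prod f f ` parcs G\<rparr>"
  have inj: "u = v" if "f u = f v" "u \<in> pverts G" "v \<in> pverts G" for u v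
    using that f by (simp add: inj_on_def)
  have arcs: "(f u, f v) \<in> parcs G' \<longleftrightarrow> (u, v) \<in> parcs G"
    if uv: "u \<in> pverts G" "v \<in> pverts G" for u v
  proof
    assume "(f u, f v) \<in> parcs G'"
    then obtain x y where "(x, y) \<in> parcs G" "f u = f x" "f v = f y"
      by (auto simp: G'_def)
    moreover from this have "u = x" "v = y"
      using uv inj in_arcsD1 in_arcsD2 by blast+
    ultimately show "(u, v) \<in> parcs G" by simp
  qed (force simp: G'_def)
  have G': "pair_graph G'"
  proof
    show "symmetric (with_proj G')"
      using pair_sym_arcs by (auto simp: symmetric_def G'_def sym_def)
    show "fst e \<noteq> snd e" if "e \<in> parcs G'" for e
    proof
      assume "fst e = snd e"
      with that obtain x y where "(x, y) \<in> parcs G" "f x = f y" by (auto simp: G'_def)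
      moreover from this have "x = y" using inj in_arcsD1 in_arcsD2 by blast
      ultimately show False using pair_no_loops by fastforce
    qed
    show "finite (pverts G')" "finite (parcs G')"
      using pair_finite_verts pair_finite_arcs by (simp_all add: G'_def)
    show "fst e \<in> pverts G'" "snd e \<in> pverts G'" if "e \<in> parcs G'" for e
      using that in_arcsD1 in_arcsD2 by (auto simp: G'_def)
  qed
  have "vertex_arrow G' r"
  proof (rule ccontr)
    assume "\<not> vertex_arrow G' r"
    then obtain c where c: "c ` pverts G' \<subseteq> {..<r}" "\<forall>(u, v) \<in> parcs G'. c u \<noteq> c v"
      using vertex_arrow_iff_not_colourable[OF G'] by blast
    have "(c \<circ> f) ` pverts G \<subseteq> {..<r} \<and> (\<forall>(u, v) \<in> parcs G. (c \<circ> f) u \<noteq> (c \<circ> f) v)"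
      using c by (force simp: G'_def)
    then show False using arr vertex_arrow_iff_not_colourable[OF G] by blast
  qed
  moreover have "card ` {K. is_clique G' K} = card ` {K. is_clique G K}"
  proof (intro equalityI subsetI)
    fix n assume "n \<in> card ` {K. is_clique G' K}"
    then obtain K where K: "is_clique G' K" "n = card K" by blast
    then have "K \<subseteq> f ` pverts G" by (simp add: is_clique_def G'_def)
    then obtain L where L: "L \<subseteq> pverts G" "K = f ` L" by (auto simp: subset_image_iff)
    have "is_clique G L"
      unfolding is_clique_def
    proof (intro conjI ballI impI)
      fix u v assume uv: "u \<in> L" "v \<in> L" "u \<noteq> v"
      then have "f u \<noteq> f v" using f L by (meson inj_onD subsetD)
      with uv K L show "(u, v) \<in> parcs G" using arcs[of u v] by (auto simp: is_clique_def)
    qed (use L in auto)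
    moreover have "n = card L" using K L f by (simp add: card_image inj_on_subset)
    ultimately show "n \<in> card ` {K. is_clique G K}" by blast
  next
    fix n assume "n \<in> card ` {K. is_clique G K}"
    then obtain K where K: "is_clique G K" "n = card K" by blast
    then have sub: "K \<subseteq> pverts G" by (simp add: is_clique_def)
    have "is_clique G' (f ` K)"
      unfolding is_clique_def
    proof (intro conjI ballI impI)
      show "f ` K \<subseteq> pverts G'" using sub by (auto simp: G'_def)
      fix x y assume "x \<in> f ` K" "y \<in> f ` K" "x \<noteq> y"
      then obtain u v where uv: "u \<in> K" "v \<in> K" "u \<noteq> v" "x = f u" "y = f v" by blast
      then have "(u, v) \<in> parcs G" using K by (simp add: is_clique_def)
      then show "(x, y) \<in> parcs G'" using uv sub arcs[of u v] by blast
    qed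
    moreover have "card (f ` K) = n"
      using K sub f by (simp add: card_image inj_on_subset)
    ultimately show "n \<in> card ` {K. is_clique G' K}" by blast
  qed
  then have "clique_number G' < q" using cl by (simp add: clique_number_def)
  ultimately have "G' \<in> H_v r q" using G' by (simp add: H_v_def)
  then have "\<exists>H \<in> (H_v r q :: nat pair_pre_digraph set). card (pverts H) = card (pverts G')"
    by blast
  then have "F_v r q \<le> card (pverts G')" unfolding F_v_def by (rule Least_le)
  moreover have "card (pverts G') = card (pverts G)" using f by (simp add: G'_def card_image)
  ultimately show ?thesis by simp
qed

end

(* Joins add chromatic numbers, clique numbers and orders. Since R(3,6) = 18, there is a graph on
   17 vertices with independence number 2, hence chromatic number at least 9, and clique number 5.
   Joining it with s copies of C_5 (chromatic number 3, clique number 2) and r - 3s - 8 copies of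
   K_1 gives chromatic number at least r + 1, clique number r - s - 3 and r + 2s + 9 vertices. *)

theory Submission
  imports Defs
begin

section \<open>Cliques and colourings\<close>

lemma pair_graphD:
  assumes "pair_graph G"
  shows "finite (pverts G)"
    and "(u, v) \<in> parcs G \<Longrightarrow> u \<in> pverts G \<and> v \<in> pverts G"
    and "(u, v) \<in> parcs G \<Longrightarrow> u \<noteq> v"
    and "(u, v) \<in> parcs G \<Longrightarrow> (v, u) \<in> parcs G"
proof -
  interpret pair_graph G by fact
  show "finite (pverts G)" by (rule pair_finite_verts)
  show "u \<in> pverts G \<and> v \<in> pverts G" if "(u, v) \<in> parcs G"
    using in_arcsD1[OF that] in_arcsD2[OF that] ..
  show "u \<noteq> v" if "(u, v) \<in> parcs G" using pair_no_loops[OF that] by simp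
  show "(v, u) \<in> parcs G" if "(u, v) \<in> parcs G"
    using pair_sym_arcs that by (simp add: symmetric_def sym_def)
qed

lemma clique_number_less_iff:
  assumes "finite (pverts G)"
  shows "clique_number G < q \<longleftrightarrow> (\<forall>K. is_clique G K \<longrightarrow> card K < q)"
proof -
  have "{K. is_clique G K} \<subseteq> Pow (pverts G)" by (auto simp: is_clique_def)
  then have "finite {K. is_clique G K}" using assms by (simp add: finite_subset)
  \<comment> \<open>The empty clique makes the set of clique sizes nonempty, so that
    \<open>Max\<close> is meaningful.\<close>
  moreover have "is_clique G {}" by (simp add: is_clique_def)
  ultimately show ?thesis unfolding clique_number_def by (subst Max_less_iff) auto
qed

text \<open>Renumbering the colours in use from 0 would otherwise give a proper colouring with
  \<open>r\<close> colours. The colours themselves are arbitrary, since a part of a join may use any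
  subset of the palette.\<close>

lemma card_colours_gt:
  assumes "pair_graph G" and arrow: "vertex_arrow G r"
    and proper: "\<And>u v. (u, v) \<in> parcs G \<Longrightarrow> c u \<noteq> c v"
  shows "r < card (c ` pverts G)"
proof (rule ccontr)
  note G = pair_graphD[OF \<open>pair_graph G\<close>]
  assume "\<not> r < card (c ` pverts G)"
  then have "{0..<card (c ` pverts G)} \<subseteq> {..<r}" by auto
  moreover obtain h where h: "bij_betw h (c ` pverts G) {0..<card (c ` pverts G)}"
    using ex_bij_betw_finite_nat G(1) by blast
  ultimately have "(h \<circ> c) ` pverts G \<subseteq> {..<r}"
    by (metis bij_betw_imp_surj_on image_comp)
  moreover have "h (c u) \<noteq> h (c v)" if uv: "(u, v) \<in> parcs G" for u v
    using inj_onD[OF bij_betw_imp_inj_on[OF h]] proper[OF uv] G(2)[OF uv] by blast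
  then have "\<forall>(u, v) \<in> parcs G. (h \<circ> c) u \<noteq> (h \<circ> c) v" by auto
  ultimately show False
    using arrow vertex_arrow_iff_not_colourable[OF \<open>pair_graph G\<close>] by blast
qed

section \<open>Joins\<close>

text \<open>The index in each vertex keeps the parts disjoint, so one graph may occur several times
  as a part.\<close>

definition join_graph :: "'i set \<Rightarrow> ('i \<Rightarrow> 'a pair_pre_digraph) \<Rightarrow> ('i \<times> 'a) pair_pre_digraph" where
  "join_graph I G = \<lparr>pverts = (SIGMA i:I. pverts (G i)),
     parcs = {((i, u), (j, v)) | i u j v. i \<in> I \<and> u \<in> pverts (G i) \<and> j \<in> I \<and> v \<in> pverts (G j) \<and>
       (i = j \<longrightarrow> (u, v) \<in> parcs (G i))}\<rparr>"

lemma pair_graph_join_graph: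
  assumes I: "finite I" and G: "\<And>i. i \<in> I \<Longrightarrow> pair_graph (G i)"
  shows "pair_graph (join_graph I G)"
proof
  show fin: "finite (pverts (join_graph I G))"
    using I pair_graphD(1)[OF G] by (simp add: join_graph_def)
  show verts: "fst e \<in> pverts (join_graph I G)" "snd e \<in> pverts (join_graph I G)"
    if "e \<in> parcs (join_graph I G)" for e
    using that by (auto simp: join_graph_def)
  have "parcs (join_graph I G) \<subseteq> pverts (join_graph I G) \<times> pverts (join_graph I G)"
    using verts by fastforce
  then show "finite (parcs (join_graph I G))" using fin by (simp add: finite_subset)
  show "fst e \<noteq> snd e" if "e \<in> parcs (join_graph I G)" for e
    using that pair_graphD(3)[OF G] by (auto simp: join_graph_def)
  show "symmetric (with_proj (join_graph I G))"
    using pair_graphD(4)[OF G] by (auto simp: symmetric_def sym_def join_graph_def)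
qed

text \<open>A clique of the join is the disjoint union of its slices, and each slice is a clique of
  its part.\<close>

lemma clique_number_join_graph:
  assumes I: "finite I" and G: "\<And>i. i \<in> I \<Longrightarrow> finite (pverts (G i))"
    and w: "\<And>i. i \<in> I \<Longrightarrow> clique_number (G i) \<le> w i"
  shows "clique_number (join_graph I G) \<le> (\<Sum>i\<in>I. w i)"
proof -
  have fin: "finite (pverts (join_graph I G))" using I G by (simp add: join_graph_def)
  have "card K \<le> (\<Sum>i\<in>I. w i)" if K: "is_clique (join_graph I G) K" for K
  proof -
    let ?S = "\<lambda>i. {u. (i, u) \<in> K}"
    have sub: "K \<subseteq> (SIGMA i:I. pverts (G i))"
      using K by (simp add: is_clique_def join_graph_def)
    have slice: "is_clique (G i) (?S i)" for i
      unfolding is_clique_def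
    proof (intro conjI ballI impI)
      show "?S i \<subseteq> pverts (G i)" using sub by auto
      fix u v assume "u \<in> ?S i" "v \<in> ?S i" "u \<noteq> v"
      then have "((i, u), (i, v)) \<in> parcs (join_graph I G)"
        using K by (auto simp: is_clique_def)
      then show "(u, v) \<in> parcs (G i)" by (simp add: join_graph_def)
    qed
    have "K = (SIGMA i:I. ?S i)" using sub by auto
    also have "card \<dots> = (\<Sum>i\<in>I. card (?S i))"
    proof (rule card_SigmaI[OF I], intro ballI)
      show "finite (?S i)" if "i \<in> I" for i
        using slice[of i] G[OF that] by (auto simp: is_clique_def intro: finite_subset)
    qed
    also have "\<dots> \<le> (\<Sum>i\<in>I. w i)"
    proof (rule sum_mono)
      fix i assume i: "i \<in> I"
      then have "clique_number (G i) < Suc (w i)" using w by (simp add: less_Suc_eq_le)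
      then show "card (?S i) \<le> w i"
        using slice clique_number_less_iff[OF G[OF i]] less_Suc_eq_le by blast
    qed
    finally show ?thesis .
  qed
  then have "clique_number (join_graph I G) < Suc (\<Sum>i\<in>I. w i)"
    by (subst clique_number_less_iff[OF fin]) (simp add: less_Suc_eq_le)
  then show ?thesis by simp
qed

text \<open>Vertices in different parts are adjacent, so a proper colouring uses disjoint sets of
  colours on the parts, with at least \<open>Suc (k i)\<close> colours on part
  \<open>i\<close>.\<close>

lemma vertex_arrow_join_graph:
  assumes I: "finite I" and G: "\<And>i. i \<in> I \<Longrightarrow> pair_graph (G i)"
    and arrow: "\<And>i. i \<in> I \<Longrightarrow> vertex_arrow (G i) (k i)"
    and r: "r < (\<Sum>i\<in>I. Suc (k i))"
  shows "vertex_arrow (join_graph I G) r"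
proof (rule ccontr)
  let ?J = "join_graph I G"
  assume "\<not> vertex_arrow ?J r"
  then obtain c where col: "c ` pverts ?J \<subseteq> {..<r}" and "\<forall>(x, y) \<in> parcs ?J. c x \<noteq> c y"
    using vertex_arrow_iff_not_colourable[of ?J r] pair_graph_join_graph[of I G] I G by blast
  then have proper: "c x \<noteq> c y" if "(x, y) \<in> parcs ?J" for x y using that by blast
  let ?C = "\<lambda>i. (\<lambda>u. c (i, u)) ` pverts (G i)"
  have "Suc (k i) \<le> card (?C i)" if i: "i \<in> I" for i
    using card_colours_gt[OF G[OF i] arrow[OF i], of "\<lambda>u. c (i, u)"] proper pair_graphD(2)[OF G[OF i]] i
    by (auto simp: join_graph_def Suc_le_eq)
  then have "(\<Sum>i\<in>I. Suc (k i)) \<le> (\<Sum>i\<in>I. card (?C i))" by (rule sum_mono)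
  also have "\<dots> = card (\<Union>i\<in>I. ?C i)"
  proof (rule card_UN_disjoint[symmetric])
    show "\<forall>i\<in>I. finite (?C i)"
      using pair_graphD(1)[OF G] by simp
    show "\<forall>i\<in>I. \<forall>j\<in>I. i \<noteq> j \<longrightarrow> ?C i \<inter> ?C j = {}"
      using proper by (fastforce simp: join_graph_def)
  qed (rule I)
  also have "\<dots> \<le> card {..<r}"
    using col by (intro card_mono) (auto simp: join_graph_def)
  finally show False using r by simp
qed

lemma join_graph_in_H_v:
  assumes "finite I" and G: "\<And>i. i \<in> I \<Longrightarrow> G i \<in> H_v (k i) (Suc (w i))"
    and "r < (\<Sum>i\<in>I. Suc (k i))" and "(\<Sum>i\<in>I. w i) < q"
  shows "join_graph I G \<in> H_v r q"
proof -
  have "pair_graph (G i)" "vertex_arrow (G i) (k i)" "clique_number (G i) \<le> w i" if "i \<in> I" for i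
    using G[OF that] by (simp_all add: H_v_def)
  moreover from this have "finite (pverts (G i))" if "i \<in> I" for i
    using that pair_graphD(1) by blast
  ultimately show ?thesis
    using assms pair_graph_join_graph[of I G] vertex_arrow_join_graph[of I G k r]
      clique_number_join_graph[of I G w] by (auto simp: H_v_def)
qed

section \<open>Graphs with independence number at most two\<close>

text \<open>An executable search for a clique of \<open>k\<close> vertices, branching on the first
  vertex: either it is taken and only its neighbours are kept, or it is dropped.\<close>

fun clique_free :: "('a \<Rightarrow> 'a \<Rightarrow> bool) \<Rightarrow> nat \<Rightarrow> 'a list \<Rightarrow> bool" where
  "clique_free E 0 xs \<longleftrightarrow> False"
| "clique_free E (Suc k) [] \<longleftrightarrow> True"
| "clique_free E (Suc k) (x # xs) \<longleftrightarrow>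
     clique_free E k (filter (E x) xs) \<and> clique_free E (Suc k) xs"

lemma card_less_if_clique_free:
  assumes "clique_free E k xs" "K \<subseteq> set xs" "pairwise E K"
  shows "card K < k"
  using assms
proof (induction E k xs arbitrary: K rule: clique_free.induct)
  case (3 E k x xs)
  have fin: "finite K" using "3.prems" by (meson finite_set finite_subset)
  show ?case
  proof (cases "x \<in> K")
    case True
    have "K - {x} \<subseteq> set (filter (E x) xs)"
      using "3.prems" True by (auto simp: pairwise_def)
    then have "card (K - {x}) < k"
      using 3 by (auto intro: pairwise_mono)
    then show ?thesis using True fin by (simp add: card_Diff_singleton)
  next
    case False
    then show ?thesis using 3 by auto
  qed
qed auto

text \<open>\<open>N ! u\<close> lists the non-neighbours of \<open>u\<close>; each non-adjacent pair need only be listed once.\<close>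

definition co_adj :: "nat list list \<Rightarrow> nat \<Rightarrow> nat \<Rightarrow> bool" where
  "co_adj N u v \<longleftrightarrow> u \<noteq> v \<and> v \<notin> set (N ! u) \<and> u \<notin> set (N ! v)"

definition co_graph :: "nat list list \<Rightarrow> nat pair_pre_digraph" where
  "co_graph N = \<lparr>pverts = {..<length N},
     parcs = {(u, v). u < length N \<and> v < length N \<and> co_adj N u v}\<rparr>"

lemma pair_graph_co_graph: "pair_graph (co_graph N)"
proof
  have "parcs (co_graph N) \<subseteq> {..<length N} \<times> {..<length N}" by (auto simp: co_graph_def)
  then show "finite (parcs (co_graph N))" by (rule finite_subset) simp
qed (auto simp: co_graph_def co_adj_def symmetric_def sym_def)

text \<open>The second check excludes three independent vertices. Colour classes then have at most
  two vertices, and \<open>r\<close> of them cannot cover more than \<open>2 * r\<close>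
  vertices.\<close>

lemma co_graph_in_H_v:
  assumes clique: "clique_free (co_adj N) q [0..<length N]"
    and indep: "clique_free (\<lambda>u v. \<not> co_adj N u v) 3 [0..<length N]"
    and r: "2 * r < length N"
  shows "co_graph N \<in> H_v r q"
proof -
  have "card K < q" if "is_clique (co_graph N) K" for K
    using that
    by (intro card_less_if_clique_free[OF clique])
      (auto simp: is_clique_def co_graph_def pairwise_def)
  then have "clique_number (co_graph N) < q"
    by (subst clique_number_less_iff) (simp_all add: co_graph_def)
  moreover have "vertex_arrow (co_graph N) r"
  proof (rule ccontr)
    assume "\<not> vertex_arrow (co_graph N) r"
    then obtain c where c: "c ` {..<length N} \<subseteq> {..<r}"
      "\<And>u v. u < length N \<Longrightarrow> v < length N \<Longrightarrow> co_adj N u v \<Longrightarrow> c u \<noteq> c v"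
      using vertex_arrow_iff_not_colourable[OF pair_graph_co_graph]
      by (fastforce simp: co_graph_def)
    let ?P = "\<lambda>i. {u. u < length N \<and> c u = i}"
    have "card (?P i) \<le> 2" for i
    proof -
      have "card (?P i) < 3"
        using c(2)
        \<comment> \<open>A colour class is a clique for the non-adjacency relation.\<close>
        by (intro card_less_if_clique_free[OF indep]) (fastforce simp: pairwise_def)+
      then show ?thesis by simp
    qed
    then have "(\<Sum>i<r. card (?P i)) \<le> r * 2" using sum_bounded_above[of "{..<r}" _ "2::nat"] by simp
    moreover have "(\<Union>i<r. ?P i) = {..<length N}" using c(1) by auto
    then have "length N \<le> (\<Sum>i<r. card (?P i))"
      using card_UN_le[of "{..<r}" ?P] card_lessThan[of "length N"] by (metis finite_lessThan)
    ultimately show False using r by simp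
  qed
  ultimately show ?thesis using pair_graph_co_graph by (simp add: H_v_def)
qed

text \<open>
  The non-edges form a triangle-free graph on 17 vertices without 6 independent vertices. It was
  found by computer among the graphs invariant under a permutation of cycle type
  \<open>(4, 4, 4, 4, 1)\<close>.
\<close>

definition ramsey_17 :: "nat list list" where
  "ramsey_17 = [[1, 3, 5, 9, 15], [2, 6, 10, 12], [3, 7, 11, 13], [4, 8, 14],
     [6, 9, 10, 12], [7, 10, 11, 13], [8, 11, 14], [8, 9, 15], [12, 16], [13, 16], [14, 16],
     [15, 16], [13, 15], [14], [15], [], []]"

lemma co_graph_ramsey_17_in_H_v: "co_graph ramsey_17 \<in> H_v 8 6"
proof (rule co_graph_in_H_v)
  show "clique_free (co_adj ramsey_17) 6 [0..<length ramsey_17]" by code_simp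
  show "clique_free (\<lambda>u v. \<not> co_adj ramsey_17 u v) 3 [0..<length ramsey_17]" by code_simp
  show "2 * 8 < length ramsey_17" by (simp add: ramsey_17_def)
qed

text \<open>The listed non-edges form a 5-cycle, whose complement is again a 5-cycle.\<close>

definition cycle_5 :: "nat list list" where
  "cycle_5 = [[1, 4], [2], [3], [4], []]"

lemma co_graph_cycle_5_in_H_v: "co_graph cycle_5 \<in> H_v 2 3"
proof (rule co_graph_in_H_v)
  show "clique_free (co_adj cycle_5) 3 [0..<length cycle_5]" by code_simp
  show "clique_free (\<lambda>u v. \<not> co_adj cycle_5 u v) 3 [0..<length cycle_5]" by code_simp
  show "2 * 2 < length cycle_5" by (simp add: cycle_5_def)
qed

text \<open>\<open>[[]]\<close> encodes the one-vertex graph; for zero colours the arrow only says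
  that a vertex exists.\<close>

lemma co_graph_singleton_in_H_v: "co_graph [[]] \<in> H_v 0 2"
  by (rule co_graph_in_H_v) (simp_all add: numeral_eq_Suc)

theorem theorem5p2:
  fixes r s :: nat
  assumes "r \<ge> 3 * s + 8"
  shows "F_v r (r - s - 2) \<le> r + 2 * s + 9"
proof -
  \<comment> \<open>An entry \<open>(N, k, w)\<close> records that \<open>co_graph N\<close> needs
    more than \<open>k\<close> colours and has clique number at most \<open>w\<close>.\<close>
  define L :: "(nat list list \<times> nat \<times> nat) list" where
    "L = (ramsey_17, 8, 5) # replicate s (cycle_5, 2, 2) @ replicate (r - 3 * s - 8) ([[]], 0, 1)"
  \<comment> \<open>Stated for every \<open>f\<close>, because it evaluates the colour bound, the
    clique bound and the order alike.\<close>
  have L_sum: "(\<Sum>i<length L. f (L ! i)) =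
      f (ramsey_17, 8, 5) + s * f (cycle_5, 2, 2) + (r - 3 * s - 8) * f ([[]], 0, 1)"
    for f :: "nat list list \<times> nat \<times> nat \<Rightarrow> nat"
  proof -
    have "(\<Sum>i<length L. f (L ! i)) = sum_list (map f L)"
      by (simp add: sum_list_sum_nth atLeast0LessThan)
    then show ?thesis by (simp add: L_def sum_list_replicate)
  qed
  let ?G = "\<lambda>i. co_graph (fst (L ! i))"
  have "\<forall>(N, k, w) \<in> set L. co_graph N \<in> H_v k (Suc w)"
    using co_graph_ramsey_17_in_H_v co_graph_cycle_5_in_H_v co_graph_singleton_in_H_v
    by (auto simp: L_def numeral_eq_Suc)
  then have "?G i \<in> H_v (fst (snd (L ! i))) (Suc (snd (snd (L ! i))))" if "i < length L" for i
    using nth_mem[OF that] by (auto simp: case_prod_beta)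
  \<comment> \<open>The sum is 9 + 3s + (r - 3s - 8) = r + 1.\<close>
  moreover have "r < (\<Sum>i<length L. Suc (fst (snd (L ! i))))"
    using assms L_sum[of "\<lambda>x. Suc (fst (snd x))"] by simp
  \<comment> \<open>The sum is 5 + 2s + (r - 3s - 8) = r - s - 3; the hypothesis on \<open>r\<close>
    keeps the truncated subtractions exact.\<close>
  moreover have "(\<Sum>i<length L. snd (snd (L ! i))) < r - s - 2"
    using assms L_sum[of "\<lambda>x. snd (snd x)"] by simp
  ultimately have "join_graph {..<length L} ?G \<in> H_v r (r - s - 2)"
    by (intro join_graph_in_H_v) auto
  then have "F_v r (r - s - 2) \<le> card (pverts (join_graph {..<length L} ?G))"
    by (rule F_v_le_card)
  also have "\<dots> = (\<Sum>i<length L. length (fst (L ! i)))"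
    by (simp add: join_graph_def co_graph_def)
  \<comment> \<open>The orders add up to 17 + 5s + (r - 3s - 8).\<close>
  also have "\<dots> = r + 2 * s + 9"
    using assms L_sum[of "\<lambda>x. length (fst x)"] by (simp add: ramsey_17_def cycle_5_def)
  finally show ?thesis .
qed

end
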